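(* Let $n\ge 1$ be an integer, let $P_{1,\mathrm{exp}}>0$ be fixed, and let $P_{\mathrm{tot}}\ge 0$. For positive real numbers $P_{2,\mathrm{exp}},\ldots,P_{n,\mathrm{exp}}$ such that $P_{1,\mathrm{exp}},P_{2,\mathrm{exp}},\ldots,P_{n,\mathrm{exp}}$ are pairwise distinct, let $$\mathrm{prob}(P\ge P_{\mathrm{tot}})=\sum_{i=1}^{n}\frac{P_{i,\mathrm{exp}}^{\,n-1}\,e^{-P_{\mathrm{tot}}/P_{i,\mathrm{exp}}}}{\prod_{1\le j\le n,\ j\ne i}\left(P_{i,\mathrm{exp}}-P_{j,\mathrm{exp}}\right)}.$$ Then, as $P_{i,\mathrm{exp}}\to P_{1,\mathrm{exp}}$ for all $i=2,\ldots,n$ (through values for which $P_{1,\mathrm{exp}},\ldots,P_{n,\mathrm{exp}}$ are pairwise distinct), $$\lim_{P_{i,\mathrm{exp}}\to P_{1,\mathrm{exp}}}\mathrm{prob}(P\ge P_{\mathrm{tot}})=e^{-P_{\mathrm{tot}}/P_{1,\mathrm{exp}}}\sum_{i=0}^{n-1}\frac{(P_{\mathrm{tot}}/P_{1,\mathrm{exp}})^i}{i!}.$$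
   Context: The displayed expression $\mathrm{prob}(P\ge P_{\mathrm{tot}})$ is the probability that the sum $P$ of $n$ independent exponentially distributed random variables with pairwise distinct expected values $P_{1,\mathrm{exp}},\ldots,P_{n,\mathrm{exp}}$ is at least $P_{\mathrm{tot}}$; the claim concerns the limit of this expression when all expected values tend to the common value $P_{1,\mathrm{exp}}$. An empty product equals $1$, and the $i=0$ term of the sum on the right-hand side equals $1$. *)

theory Defs
  imports "HOL-Analysis.Analysis"
begin

text \<open>
  Families \<open>p\<close> of type \<^typ>\<open>nat \<Rightarrow> real\<close> stand for the tuple of expected values
  \<open>(p 1, \<dots>, p n)\<close>; values of \<open>p\<close> outside \<open>{1..n}\<close> are irrelevant.
\<close>

definition prob_ge :: "nat \<Rightarrow> (nat \<Rightarrow> real) \<Rightarrow> real \<Rightarrow> real" where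
  "prob_ge n p P_tot =
     (\<Sum>i = 1..n. p i ^ (n - 1) * exp (- P_tot / p i) / (\<Prod>j \<in> {1..n} - {i}. p i - p j))"

definition admissible :: "nat \<Rightarrow> real \<Rightarrow> (nat \<Rightarrow> real) set" where
  "admissible n P1 = {p. p 1 = P1 \<and> (\<forall>i \<in> {2..n}. p i > 0) \<and> inj_on p {1..n}}"

text \<open>
  The joint limit \<open>p i \<rightarrow> P1\<close> for \<open>i = 2, \<dots>, n\<close> is taken along the filter
  \<open>at (\<lambda>_. P1) within admissible n P1\<close> for the product topology on \<^typ>\<open>nat \<Rightarrow> real\<close>.
  Since \<open>prob_ge n p\<close> and \<open>admissible n P1\<close> depend only on \<open>p 1, \<dots>, p n\<close>, this is the
  limit in \<open>n - 1\<close> real variables. The filter is proper for every \<open>n \<ge> 1\<close>: the unconstrained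
  coordinates keep it proper when \<open>n = 1\<close>, where there is no variable and the limit is
  just the value.
\<close>

end

theory Submission
  imports Defs
begin

text \<open>
  The sum defining \<^const>\<open>prob_ge\<close> is a divided difference: with \<open>m = n - 1\<close> and
  \<open>g x = x ^ m * exp (- T / x)\<close>, it is \<open>g[p 1, \<dots>, p n]\<close> in Newton's notation. Although each
  summand blows up as the nodes merge, a divided difference over \<open>m + 1\<close> distinct nodes
  equals the \<open>m\<close>-th derivative of \<open>g\<close> over \<open>m!\<close> at some point of any interval containing
  the nodes (\<open>divided_difference_mean_value\<close>). When all nodes tend to \<open>P1\<close>, so does that
  point, and by continuity the limit is the \<open>m\<close>-th derivative of \<open>g\<close> at \<open>P1\<close> over \<open>m!\<close>.

  The mean value statement is the classical one: \<open>g\<close> minus its Lagrange interpolant has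
  \<open>m + 1\<close> zeros, hence by iterating Rolle's theorem its \<open>m\<close>-th derivative has a zero, and the
  \<open>m\<close>-th derivative of the interpolant is \<open>m!\<close> times its leading coefficient, which is the
  divided difference.

  It remains to differentiate \<open>g\<close>. The derivative of order \<open>m - r\<close> has the closed form
  \<open>(m - r)! * exp (- T / x) * (\<Sum>i\<le>m. (m - i choose r) * T ^ i / i! * x powi (r - i))\<close>
  (\<open>power_exp_deriv\<close> below); for \<open>r = 0\<close> all binomial coefficients are \<open>1\<close>, which
  leaves the truncated exponential series of \<open>T / x\<close>.
\<close>

section \<open>Rolle's theorem for many zeros\<close>

lemma Rolle_many_zeros:
  fixes f f' :: "real \<Rightarrow> real"
  assumes I: "is_interval I"
    and deriv: "\<And>x. x \<in> I \<Longrightarrow> (f has_real_derivative f' x) (at x)"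
    and A: "finite A" "A \<subseteq> I" "\<And>x. x \<in> A \<Longrightarrow> f x = 0"
  shows "\<exists>B. finite B \<and> B \<subseteq> I \<and> (\<forall>x\<in>B. f' x = 0) \<and> card A \<le> Suc (card B)"
proof -
  \<comment> \<open>Bounding the new zeros by \<open>Max A\<close> makes the one found beyond \<open>Max A\<close> a fresh one.\<close>
  have "\<exists>B. finite B \<and> B \<subseteq> I \<and> (\<forall>x\<in>B. f' x = 0 \<and> (\<exists>a\<in>A. x \<le> a)) \<and> card A \<le> Suc (card B)"
    using A
  proof (induction A rule: finite_linorder_max_induct)
    case empty
    show ?case by (rule exI[of _ "{}"]) simp
  next
    case (insert b A)
    then obtain B where B: "finite B" "B \<subseteq> I" "\<forall>x\<in>B. f' x = 0 \<and> (\<exists>a\<in>A. x \<le> a)"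
      "card A \<le> Suc (card B)"
      by auto
    show ?case
    proof (cases "A = {}")
      case True
      then show ?thesis by (intro exI[of _ "{}"]) simp
    next
      case False
      define c where "c = Max A"
      have c: "c \<in> A" "c < b" "\<And>a. a \<in> A \<Longrightarrow> a \<le> c"
        using insert.hyps False by (auto simp: c_def)
      have mem: "x \<in> I" if "c \<le> x" "x \<le> b" for x
        using mem_is_interval_1_I[OF I, of c b x] c insert.prems that by auto
      have "\<exists>z. c < z \<and> z < b \<and> (f has_real_derivative 0) (at z)"
      proof (rule Rolle)
        show "continuous_on {c..b} f"
          by (intro continuous_at_imp_continuous_on ballI DERIV_isCont[OF deriv] mem) auto
        show "f differentiable (at x)" if "c < x" "x < b" for x
          using deriv[OF mem, of x] that real_differentiable_def by auto
      qed (use c insert.prems in auto)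
      then obtain z where z: "c < z" "z < b" "(f has_real_derivative 0) (at z)"
        by auto
      have "z \<in> I" using mem z by auto
      moreover have "f' z = 0"
        using DERIV_unique[OF z(3) deriv[OF \<open>z \<in> I\<close>]] by simp
      moreover have "z \<notin> B"
        using B(3) c(3) z(1) by fastforce
      moreover have "b \<notin> A" using insert.hyps by auto
      ultimately show ?thesis
        using B z insert.hyps by (intro exI[of _ "insert z B"]) (auto intro: less_imp_le)
    qed
  qed
  then show ?thesis by blast
qed

lemma Rolle_iterated:
  fixes F :: "nat \<Rightarrow> real \<Rightarrow> real"
  assumes I: "is_interval I"
    and deriv: "\<And>k x. k < m \<Longrightarrow> x \<in> I \<Longrightarrow> (F k has_real_derivative F (Suc k) x) (at x)"
    and A: "finite A" "A \<subseteq> I" "\<And>x. x \<in> A \<Longrightarrow> F 0 x = 0" "card A > m"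
  shows "\<exists>x\<in>I. F m x = 0"
proof -
  have "\<exists>B. finite B \<and> B \<subseteq> I \<and> (\<forall>x\<in>B. F k x = 0) \<and> card A \<le> k + card B" if "k \<le> m" for k
    using that
  proof (induction k)
    case 0
    then show ?case using A by auto
  next
    case (Suc k)
    then obtain B where B: "finite B" "B \<subseteq> I" "\<forall>x\<in>B. F k x = 0" "card A \<le> k + card B"
      by auto
    obtain C where "finite C" "C \<subseteq> I" "\<forall>x\<in>C. F (Suc k) x = 0" "card B \<le> Suc (card C)"
      using Rolle_many_zeros[OF I deriv[of k] B(1,2)] B(3) Suc.prems by auto
    then show ?case using B(4) by (intro exI[of _ C]) simp
  qed
  from this[of m] obtain B where B: "B \<subseteq> I" "\<forall>x\<in>B. F m x = 0" "card A \<le> m + card B"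
    by blast
  then have "B \<noteq> {}" using A(4) by auto
  with B show ?thesis by blast
qed

section \<open>Divided differences\<close>

text \<open>
  Newton's recursively defined \<open>f[a\<^sub>0, \<dots>, a\<^sub>m]\<close> in its explicit form. It is
  symmetric in the nodes, so a set suffices to describe them.
\<close>

definition divided_difference :: "(real \<Rightarrow> real) \<Rightarrow> real set \<Rightarrow> real" where
  "divided_difference f A = (\<Sum>a\<in>A. f a / (\<Prod>b\<in>A - {a}. a - b))"

definition lagrange_interpolant :: "(real \<Rightarrow> real) \<Rightarrow> real set \<Rightarrow> real poly" where
  "lagrange_interpolant f A =
     (\<Sum>a\<in>A. smult (f a / (\<Prod>b\<in>A - {a}. a - b)) (\<Prod>b\<in>A - {a}. [:- b, 1:]))"

lemma poly_lagrange_interpolant: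
  assumes "finite A" "x \<in> A"
  shows "poly (lagrange_interpolant f A) x = f x"
proof -
  have "poly (lagrange_interpolant f A) x =
      (\<Sum>a\<in>A. f a / (\<Prod>b\<in>A - {a}. a - b) * (\<Prod>b\<in>A - {a}. x - b))"
    by (simp add: lagrange_interpolant_def poly_sum poly_prod)
  also have "\<dots> = (\<Sum>a\<in>A. if a = x then f x else 0)"
    using assms by (intro sum.cong) (auto simp: prod_zero_iff)
  also have "\<dots> = f x"
    using assms by simp
  finally show ?thesis .
qed

lemma degree_prod_linear:
  fixes B :: "'a :: idom set"
  shows "degree (\<Prod>b\<in>B. [:- b, 1:]) = card B"
  by (subst degree_prod_eq_sum_degree) auto

lemma higher_pderiv_lagrange_interpolant:
  assumes "finite A" "card A = Suc m"
  shows "poly ((pderiv ^^ m) (lagrange_interpolant f A)) x = fact m * divided_difference f A"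
proof -
  let ?Q = "lagrange_interpolant f A"
  have basis: "degree (\<Prod>b\<in>A - {a}. [:- b, 1:]) = m"
    "coeff (\<Prod>b\<in>A - {a}. [:- b, 1:]) m = 1" if "a \<in> A" for a
  proof -
    show deg: "degree (\<Prod>b\<in>A - {a}. [:- b, 1:]) = m"
      using assms that by (simp add: degree_prod_linear)
    show "coeff (\<Prod>b\<in>A - {a}. [:- b, 1:]) m = 1"
      using lead_coeff_prod[of "\<lambda>b. [:- b, 1:]" "A - {a}"] deg by simp
  qed
  have "degree ?Q \<le> m"
    unfolding lagrange_interpolant_def using assms(1) basis(1)
    by (intro degree_sum_le order.trans[OF degree_smult_le]) auto
  then have "degree ((pderiv ^^ m) ?Q) = 0"
    by (simp add: degree_higher_pderiv)
  then obtain c where c: "(pderiv ^^ m) ?Q = [:c:]"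
    by (rule degree_eq_zeroE)
  have "c = coeff ((pderiv ^^ m) ?Q) 0"
    by (simp add: c)
  also have "\<dots> = fact m * coeff ?Q m"
    by (simp add: coeff_higher_pderiv pochhammer_fact)
  also have "coeff ?Q m = divided_difference f A"
    by (simp add: lagrange_interpolant_def divided_difference_def coeff_sum basis(2))
  finally show ?thesis by (simp add: c)
qed

text \<open>
  The error of the Lagrange interpolant vanishes at all \<open>m + 1\<close> nodes, so Rolle's theorem
  applies \<open>m\<close> times.
\<close>

lemma divided_difference_mean_value:
  fixes F :: "nat \<Rightarrow> real \<Rightarrow> real"
  assumes I: "is_interval I"
    and deriv: "\<And>k x. k < m \<Longrightarrow> x \<in> I \<Longrightarrow> (F k has_real_derivative F (Suc k) x) (at x)"
    and A: "finite A" "A \<subseteq> I" "card A = Suc m"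
  shows "\<exists>x\<in>I. divided_difference (F 0) A = F m x / fact m"
proof -
  define Q where "Q = lagrange_interpolant (F 0) A"
  define E where "E k x = F k x - poly ((pderiv ^^ k) Q) x" for k x
  have "\<exists>x\<in>I. E m x = 0"
  proof (rule Rolle_iterated[OF I _ A(1,2)])
    show "(E k has_real_derivative E (Suc k) x) (at x)" if "k < m" "x \<in> I" for k x
      unfolding E_def using deriv[OF that] by (auto intro!: derivative_eq_intros poly_DERIV)
    show "E 0 x = 0" if "x \<in> A" for x
      using that A(1) by (simp add: E_def Q_def poly_lagrange_interpolant)
  qed (use A in auto)
  then obtain x where "x \<in> I" "F m x = fact m * divided_difference (F 0) A"
    using A by (auto simp: E_def Q_def higher_pderiv_lagrange_interpolant)
  then show ?thesis by (intro bexI[of _ x]) simp_all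
qed

lemma prob_ge_eq_divided_difference:
  assumes "inj_on p {1..n}"
  shows "prob_ge n p T = divided_difference (\<lambda>x. x ^ (n - 1) * exp (- T / x)) (p ` {1..n})"
proof -
  have "(\<Prod>b\<in>p ` {1..n} - {p i}. p i - b) = (\<Prod>j\<in>{1..n} - {i}. p i - p j)"
    if "i \<in> {1..n}" for i
  proof -
    have "p ` {1..n} - {p i} = p ` ({1..n} - {i})"
      using assms that unfolding inj_on_def by blast
    moreover have "inj_on p ({1..n} - {i})"
      using assms by (rule inj_on_subset) auto
    ultimately show ?thesis by (simp add: prod.reindex)
  qed
  then show ?thesis
    unfolding prob_ge_def divided_difference_def sum.reindex[OF assms] o_def
    by (intro sum.cong) simp_all
qed

section \<open>The derivatives of \<open>x ^ m * exp (- T / x)\<close>\<close>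

text \<open>
  Up to a factorial this is the derivative of order \<open>m - r\<close>. Indexing by \<open>r\<close> instead of the
  order lets the sum run over the same range for all orders, since \<open>m - i choose r\<close> vanishes
  for \<open>i > m - r\<close>.
\<close>

definition power_exp_deriv :: "real \<Rightarrow> nat \<Rightarrow> nat \<Rightarrow> real \<Rightarrow> real" where
  "power_exp_deriv T m r x =
     exp (- T / x) * (\<Sum>i\<le>m. real (m - i choose r) / fact i * T ^ i * x powi (int r - int i))"

lemma Suc_times_binomial_Suc: "Suc k * (n choose Suc k) = (n - k) * (n choose k)"
  by (simp only: binomial_absorption binomial_absorb_comp)

lemma power_exp_deriv_top: "power_exp_deriv T m m x = x ^ m * exp (- T / x)"
proof -
  have "(\<Sum>i\<le>m. real (m - i choose m) / fact i * T ^ i * x powi (int m - int i)) =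
      (\<Sum>i\<le>m. if i = 0 then x ^ m else 0)"
    by (intro sum.cong) (auto simp: binomial_eq_0)
  then show ?thesis by (simp add: power_exp_deriv_def)
qed

lemma power_exp_deriv_0:
  "power_exp_deriv T m 0 x = exp (- T / x) * (\<Sum>i\<le>m. (T / x) ^ i / fact i)"
  by (simp add: power_exp_deriv_def power_int_minus power_divide field_simps)

text \<open>
  The recurrence between the coefficients of consecutive derivatives; after cancelling
  \<open>i!\<close> it combines Pascal's rule with the identity \<open>Suc_times_binomial_Suc\<close>.
\<close>

lemma power_exp_deriv_coeff:
  assumes "i < m" "s < m"
  shows "real (m - Suc i choose Suc s) / fact (Suc i) * (real s - real i)
       + real (m - i choose Suc s) / fact i
       = real (m - s) * (real (m - Suc i choose s) / fact (Suc i))"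
proof -
  define a where "a = m - Suc i"
  have m: "m - i = Suc a" "m = Suc (a + i)" using assms by (auto simp: a_def)
  have "real (Suc s) * real (a choose Suc s) = (real a - real s) * real (a choose s)"
  proof (cases "s \<le> a")
    case True
    then show ?thesis
      using Suc_times_binomial_Suc[of s a] by (metis of_nat_diff of_nat_mult)
  qed (simp add: binomial_eq_0)
  then have "real (a choose Suc s) * (real s - real i) + real (Suc i) * real (Suc a choose Suc s)
      = real (m - s) * real (a choose s)"
    using assms by (simp add: m of_nat_diff algebra_simps)
  moreover have "real (Suc a choose Suc s) / fact i =
      real (Suc i) * real (Suc a choose Suc s) / fact (Suc i)"
    unfolding fact_Suc of_nat_mult by (subst mult_divide_mult_cancel_left) auto
  ultimately show ?thesis
    by (simp only: m(1) a_def[symmetric] times_divide_eq_left times_divide_eq_right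
        add_divide_distrib[symmetric])
qed

text \<open>
  Each summand \<open>exp (- T / x) * T ^ i * x powi (s + 1 - i)\<close> differentiates to a multiple of the
  \<open>i\<close>-th plus the \<open>(i + 1)\<close>-st term \<open>e i = exp (- T / x) * T ^ i * x powi (s - i)\<close> of the
  next derivative, so comparing coefficients of the \<open>e i\<close> leaves the recurrence above.
\<close>

lemma power_exp_deriv_has_derivative:
  assumes "x \<noteq> 0" "s < m"
  shows "(power_exp_deriv T m (Suc s) has_real_derivative
           real (m - s) * power_exp_deriv T m s x) (at x)"
proof -
  define c where "c r i = real (m - i choose r) / fact i" for r i
  define e where "e i = exp (- T / x) * T ^ i * x powi (int s - int i)" for i
  have term_deriv: "((\<lambda>x. exp (- T / x) * T ^ i * x powi (int (Suc s) - int i)) has_real_derivative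
      (real (Suc s) - real i) * e i + e (Suc i)) (at x)" for i
  proof -
    define l where "l = int s - int (Suc i)"
    have l: "int s - int i = l + 1" "int (Suc s) - int i = l + 2" "real s = of_int l + real i + 1"
      by (simp_all add: l_def)
    have "((\<lambda>x. exp (- T / x) * T ^ i * x powi (l + 2)) has_real_derivative
        (of_int l + 2) * (exp (- T / x) * T ^ i * x powi (l + 1))
        + exp (- T / x) * T ^ Suc i * x powi l) (at x)"
      using assms(1)
      by (auto intro!: derivative_eq_intros simp: power_int_add power2_eq_square field_simps)
    then show ?thesis
      unfolding e_def l l_def[symmetric] by (simp add: l(3) add.commute)
  qed
  have sum_c: "exp (- T / y) * (\<Sum>i\<le>m. c r i * T ^ i * y powi (int r - int i)) =
      (\<Sum>i\<le>m. c r i * (exp (- T / y) * T ^ i * y powi (int r - int i)))" for r y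
    by (simp add: sum_distrib_left mult_ac)
  have "(power_exp_deriv T m (Suc s) has_real_derivative
      (\<Sum>i\<le>m. c (Suc s) i * ((real (Suc s) - real i) * e i + e (Suc i)))) (at x)"
    unfolding power_exp_deriv_def[abs_def] c_def[symmetric] sum_c
    by (intro DERIV_sum DERIV_cmult term_deriv)
  also have "(\<Sum>i\<le>m. c (Suc s) i * ((real (Suc s) - real i) * e i + e (Suc i))) =
      (\<Sum>i\<le>m. c (Suc s) i * (real (Suc s) - real i) * e i) + (\<Sum>i\<le>m. c (Suc s) i * e (Suc i))"
    by (simp only: distrib_left mult.assoc sum.distrib)
  also have "(\<Sum>i\<le>m. c (Suc s) i * (real (Suc s) - real i) * e i) =
      c (Suc s) 0 * real (Suc s) * e 0
      + (\<Sum>i<m. c (Suc s) (Suc i) * (real s - real i) * e (Suc i))"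
    by (subst sum.atMost_shift) simp
  also have "(\<Sum>i\<le>m. c (Suc s) i * e (Suc i)) = (\<Sum>i<m. c (Suc s) i * e (Suc i))"
    by (simp add: c_def lessThan_Suc_atMost[symmetric])
  also have "c (Suc s) 0 * real (Suc s) = real (m - s) * c s 0"
    using arg_cong[OF Suc_times_binomial_Suc[of s m], of real]
    by (simp only: c_def of_nat_mult diff_zero fact_0 div_by_1 mult.commute)
  also have "real (m - s) * c s 0 * e 0
      + (\<Sum>i<m. c (Suc s) (Suc i) * (real s - real i) * e (Suc i))
      + (\<Sum>i<m. c (Suc s) i * e (Suc i)) =
      real (m - s) * c s 0 * e 0
      + (\<Sum>i<m. (c (Suc s) (Suc i) * (real s - real i) + c (Suc s) i) * e (Suc i))"
    by (simp only: distrib_right sum.distrib add.assoc)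
  also have "(\<Sum>i<m. (c (Suc s) (Suc i) * (real s - real i) + c (Suc s) i) * e (Suc i)) =
      (\<Sum>i<m. real (m - s) * c s (Suc i) * e (Suc i))"
    using power_exp_deriv_coeff[OF _ assms(2)] by (intro sum.cong) (simp_all add: c_def)
  also have "real (m - s) * c s 0 * e 0 + \<dots> = (\<Sum>i\<le>m. real (m - s) * c s i * e i)"
    by (subst sum.atMost_shift) simp
  also have "\<dots> = real (m - s) * power_exp_deriv T m s x"
    unfolding power_exp_deriv_def c_def[symmetric] sum_c
    by (simp add: e_def sum_distrib_left mult_ac)
  finally show ?thesis .
qed

section \<open>The limit\<close>

text \<open>
  Being valid for every interval of positive numbers around the nodes, this turns the limit into
  continuity of the right-hand side in \<open>x\<close>.
\<close>

lemma prob_ge_mean_value: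
  assumes "is_interval I" "I \<subseteq> {0<..}" "n \<ge> 1" "inj_on p {1..n}" "p ` {1..n} \<subseteq> I"
  shows "\<exists>x\<in>I. prob_ge n p T = exp (- T / x) * (\<Sum>i = 0..n - 1. (T / x) ^ i / fact i)"
proof -
  define m where "m = n - 1"
  define F where "F k x = fact k * power_exp_deriv T m (m - k) x" for k x
  have "\<exists>x\<in>I. divided_difference (F 0) (p ` {1..n}) = F m x / fact m"
  proof (rule divided_difference_mean_value[OF assms(1)])
    fix k x assume k: "k < m" and x: "x \<in> I"
    have "m - k = Suc (m - Suc k)" "m - (m - Suc k) = Suc k" using k by auto
    moreover have "x \<noteq> 0" using x assms(2) by auto
    ultimately show "(F k has_real_derivative F (Suc k) x) (at x)"
      using DERIV_cmult[OF power_exp_deriv_has_derivative[of x "m - Suc k" m T], of "fact k"] k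
      by (simp add: F_def[abs_def] mult_ac)
  qed (use assms in \<open>auto simp: card_image m_def\<close>)
  moreover have "F 0 = (\<lambda>x. x ^ (n - 1) * exp (- T / x))"
    by (simp add: F_def power_exp_deriv_top m_def fun_eq_iff)
  ultimately show ?thesis
    by (simp add: prob_ge_eq_divided_difference[OF assms(4)] F_def power_exp_deriv_0 m_def
        atLeast0AtMost)
qed

theorem mainTheorem2:
  fixes n :: nat and P1 P_tot :: real
  assumes "n \<ge> 1" and "P1 > 0" and "P_tot \<ge> 0"
  shows "((\<lambda>p. prob_ge n p P_tot) \<longlongrightarrow>
            exp (- P_tot / P1) * (\<Sum>i = 0..n - 1. (P_tot / P1) ^ i / fact i))
          (at (\<lambda>_. P1) within admissible n P1)"
proof (rule tendstoI)
  define h where "h x = exp (- P_tot / x) * (\<Sum>i = 0..n - 1. (P_tot / x) ^ i / fact i)" for x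
  fix \<epsilon> :: real assume "\<epsilon> > 0"
  have "isCont h P1"
    unfolding h_def using assms(2) by (intro continuous_intros) auto
  then obtain d where d: "d > 0" "\<And>x. dist x P1 < d \<Longrightarrow> dist (h x) (h P1) < \<epsilon>"
    using \<open>\<epsilon> > 0\<close> unfolding continuous_at_eps_delta by (auto simp: dist_real_def)
  \<comment> \<open>The radius is at most \<open>P1\<close> so that the interval stays within the positive numbers.\<close>
  define r where "r = min d P1"
  have r: "r > 0" "r \<le> d" "r \<le> P1" using d assms by (auto simp: r_def)
  let ?I = "{P1 - r<..<P1 + r}"
  let ?F = "at (\<lambda>_::nat. P1) within admissible n P1"
  have "\<forall>\<^sub>F p in ?F. p i \<in> ?I" for i
  proof -
    have "((\<lambda>p. p i) \<longlongrightarrow> P1) ?F"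
      using continuous_on_product_coordinates[of i, where ?'b = real]
      by (auto simp: continuous_on_def intro: tendsto_within_subset)
    then show ?thesis
      by (rule topological_tendstoD) (use r in auto)
  qed
  then have "\<forall>\<^sub>F p in ?F. \<forall>i\<in>{1..n}. p i \<in> ?I"
    by (intro eventually_ball_finite) auto
  moreover have "\<forall>\<^sub>F p in ?F. p \<in> admissible n P1"
    by (simp add: eventually_at_filter)
  ultimately have "\<forall>\<^sub>F p in ?F. dist (prob_ge n p P_tot) (h P1) < \<epsilon>"
  proof eventually_elim
    case (elim p)
    then have "inj_on p {1..n}" "p ` {1..n} \<subseteq> ?I"
      by (auto simp: admissible_def)
    moreover have "is_interval ?I" "?I \<subseteq> {0<..}"
      using r by (auto simp: is_interval_1)
    ultimately obtain x where "x \<in> ?I" "prob_ge n p P_tot = h x"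
      using prob_ge_mean_value[of ?I n p P_tot] assms(1) unfolding h_def by blast
    then show ?case
      using d(2)[of x] r by (auto simp: dist_real_def)
  qed
  then show "\<forall>\<^sub>F p in ?F. dist (prob_ge n p P_tot)
      (exp (- P_tot / P1) * (\<Sum>i = 0..n - 1. (P_tot / P1) ^ i / fact i)) < \<epsilon>"
    by (simp add: h_def)
qed

end
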